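(* Let $\mathbb{C}$ be a modified category of interest, let $(e;s,t:R\to S)$ be a cat$^1$-object in $\mathbb{C}$ and let $\phi:Q\to S$ be a morphism in $\mathbb{C}$. Put $$\phi^\star(R)=\{(q_1,r,q_2)\in Q\times R\times Q\mid\phi(q_1)=s(r),\ \phi(q_2)=t(r)\},$$ a subobject of $Q\times R\times Q$, and define $s^\star(q_1,r,q_2)=q_1$, $t^\star(q_1,r,q_2)=q_2$, $e^\star(q)=(q,e\phi(q),q)$ and $\pi(q_1,r,q_2)=r$. Then $(e^\star;s^\star,t^\star:\phi^\star(R)\to Q)$ is a cat$^1$-object, $(\pi,\phi)$ is a cat$^1$-morphism from it to $(e;s,t:R\to S)$, and it is the pullback cat$^1$-object of $(e;s,t:R\to S)$ along $\phi$; that is, for every cat$^1$-morphism of the form $(\varphi,\phi):(e';s',t':P\to Q)\to(e;s,t:R\to S)$ there exists a unique cat$^1$-morphism of the form $(\psi,\mathrm{id}_Q):(e';s',t':P\to Q)\to(e^\star;s^\star,t^\star:\phi^\star(R)\to Q)$ such that $(\pi,\phi)\circ(\psi,\mathrm{id}_Q)=(\varphi,\phi)$.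
   Context: **Modified category of interest (MCI).** Let $\mathbb{C}$ be a category of groups with a set of operations $\Omega$ and a set of identities $\mathbb{E}$ including the group identities. Let $\Omega_i$ be the set of $i$-ary operations in $\Omega$. $\mathbb{C}$ is an MCI if: (a) $\Omega=\Omega_0\cup\Omega_1\cup\Omega_2$; (b) the group operations (written additively, $0,-,+$, not necessarily commutative) are elements of $\Omega_0,\Omega_1,\Omega_2$ respectively; put $\Omega_2'=\Omega_2\setminus\{+\}$, $\Omega_1'=\Omega_1\setminus\{-\}$; if $\ast\in\Omega_2'$ then $\Omega_2'$ also contains $\ast^\circ$ defined by $x\ast^\circ y=y\ast x$; and $\Omega_0=\{0\}$; (c) for each $\ast\in\Omega_2'$, $\mathbb{E}$ includes $x\ast(y+z)=x\ast y+x\ast z$; (d) for each $\omega\in\Omega_1'$ and $\ast\in\Omega_2'$, $\mathbb{E}$ includes $\omega(x+y)=\omega(x)+\omega(y)$ and either $\omega(x\ast y)=\omega(x)\ast\omega(y)$ or $\omega(x\ast y)=\omega(x)\ast y$; and for every object $C$ and $x_1,x_2,x_3\in C$: (e) $x_1+(x_2\ast x_3)=(x_2\ast x_3)+x_1$ for each $\ast\in\Omega_2'$; (f) for each ordered pair $(\ast,\overline{\ast})\in\Omega_2'\times\Omega_2'$ there is a word $W$ such that $(x_1\ast x_2)\,\overline{\ast}\,x_3=W\big(x_1(x_2x_3),x_1(x_3x_2),(x_2x_3)x_1,(x_3x_2)x_1,x_2(x_1x_3),x_2(x_3x_1),(x_1x_3)x_2,(x_3x_1)x_2\big)$, where each juxtaposition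 represents an operation in $\Omega_2'$. Morphisms of $\mathbb{C}$ are maps preserving $+$ and all $\ast\in\Omega_2'$ and commuting with all $\omega\in\Omega_1'$. Products in $\mathbb{C}$ carry componentwise operations. **Cat$^1$-objects.** A cat$^1$-object $(e;s,t:R\to S)$ in $\mathbb{C}$ consists of objects $R,S$ of $\mathbb{C}$ and morphisms $s,t:R\to S$ and $e:S\to R$ (the embedding exhibiting $S$ as a subobject of $R$) such that $se=\mathrm{id}_S$, $te=\mathrm{id}_S$, and $x\ast y=0$, $x+y-x-y=0$ for all $\ast\in\Omega_2'$, $x\in\ker s$, $y\in\ker t$. A cat$^1$-morphism $(e;s,t:R\to S)\to(e';s',t':R'\to S')$ is a pair $(\phi,\varphi)$ of morphisms $\phi:R\to R'$, $\varphi:S\to S'$ of $\mathbb{C}$ with $s'\phi=\varphi s$, $t'\phi=\varphi t$ and $\phi e=e'\varphi$. *)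

theory Defs
  imports Main "HOL-Library.FuncSet"
begin

section \<open>Words and algebras over a signature of group operations\<close>

text \<open>
  The nullary, unary and binary group operations \<open>0\<close>, \<open>-\<close>, \<open>+\<close> are built into terms and
  algebras. The remaining operation symbols are those of \<open>Om1\<close> (unary, \<open>\<Omega>\<^sub>1' = \<Omega>\<^sub>1 - {-}\<close>) and
  \<open>Om2\<close> (binary, \<open>\<Omega>\<^sub>2' = \<Omega>\<^sub>2 - {+}\<close>). So \<open>\<Omega> = \<Omega>\<^sub>0 \<union> \<Omega>\<^sub>1 \<union> \<Omega>\<^sub>2\<close> and \<open>\<Omega>\<^sub>0 = {0}\<close> hold by
  construction; either of \<open>Om1\<close>, \<open>Om2\<close> may be empty.
\<close>

datatype ('u, 'b) trm =
    Var nat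
  | Zero
  | Neg "('u, 'b) trm"
  | Plus "('u, 'b) trm" "('u, 'b) trm"
  | UnOp 'u "('u, 'b) trm"
  | BinOp 'b "('u, 'b) trm" "('u, 'b) trm"

record ('u, 'b) presentation =
  Om1 :: "'u set"
  Om2 :: "'b set"
  ids :: "(('u, 'b) trm \<times> ('u, 'b) trm) set"

record ('a, 'u, 'b) alg =
  carr :: "'a set"
  zero :: 'a
  neg :: "'a \<Rightarrow> 'a"
  add :: "'a \<Rightarrow> 'a \<Rightarrow> 'a"
  un :: "'u \<Rightarrow> 'a \<Rightarrow> 'a"
  bin :: "'b \<Rightarrow> 'a \<Rightarrow> 'a \<Rightarrow> 'a"

primrec wf_trm :: "('u, 'b, 'z) presentation_scheme \<Rightarrow> ('u, 'b) trm \<Rightarrow> bool" where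
  "wf_trm T (Var n) = True"
| "wf_trm T Zero = True"
| "wf_trm T (Neg t) = wf_trm T t"
| "wf_trm T (Plus t u) = (wf_trm T t \<and> wf_trm T u)"
| "wf_trm T (UnOp w t) = (w \<in> Om1 T \<and> wf_trm T t)"
| "wf_trm T (BinOp b t u) = (b \<in> Om2 T \<and> wf_trm T t \<and> wf_trm T u)"

primrec vars :: "('u, 'b) trm \<Rightarrow> nat set" where
  "vars (Var n) = {n}"
| "vars Zero = {}"
| "vars (Neg t) = vars t"
| "vars (Plus t u) = vars t \<union> vars u"
| "vars (UnOp w t) = vars t"
| "vars (BinOp b t u) = vars t \<union> vars u"

primrec subst :: "(nat \<Rightarrow> ('u, 'b) trm) \<Rightarrow> ('u, 'b) trm \<Rightarrow> ('u, 'b) trm" where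
  "subst \<sigma> (Var n) = \<sigma> n"
| "subst \<sigma> Zero = Zero"
| "subst \<sigma> (Neg t) = Neg (subst \<sigma> t)"
| "subst \<sigma> (Plus t u) = Plus (subst \<sigma> t) (subst \<sigma> u)"
| "subst \<sigma> (UnOp w t) = UnOp w (subst \<sigma> t)"
| "subst \<sigma> (BinOp b t u) = BinOp b (subst \<sigma> t) (subst \<sigma> u)"

primrec eval :: "('a, 'u, 'b) alg \<Rightarrow> (nat \<Rightarrow> 'a) \<Rightarrow> ('u, 'b) trm \<Rightarrow> 'a" where
  "eval A v (Var n) = v n"
| "eval A v Zero = zero A"
| "eval A v (Neg t) = neg A (eval A v t)"
| "eval A v (Plus t u) = add A (eval A v t) (eval A v u)"
| "eval A v (UnOp w t) = un A w (eval A v t)"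
| "eval A v (BinOp b t u) = bin A b (eval A v t) (eval A v u)"

definition satisfies :: "('a, 'u, 'b) alg \<Rightarrow> ('u, 'b) trm \<Rightarrow> ('u, 'b) trm \<Rightarrow> bool" where
  "satisfies A l r \<longleftrightarrow> (\<forall>v. range v \<subseteq> carr A \<longrightarrow> eval A v l = eval A v r)"

definition closed_alg :: "('u, 'b) presentation \<Rightarrow> ('a, 'u, 'b) alg \<Rightarrow> bool" where
  "closed_alg T A \<longleftrightarrow>
     zero A \<in> carr A \<and>
     (\<forall>x\<in>carr A. neg A x \<in> carr A) \<and>
     (\<forall>x\<in>carr A. \<forall>y\<in>carr A. add A x y \<in> carr A) \<and>
     (\<forall>w\<in>Om1 T. \<forall>x\<in>carr A. un A w x \<in> carr A) \<and>
     (\<forall>b\<in>Om2 T. \<forall>x\<in>carr A. \<forall>y\<in>carr A. bin A b x y \<in> carr A)"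

definition obj :: "('u, 'b) presentation \<Rightarrow> ('a, 'u, 'b) alg \<Rightarrow> bool" where
  "obj T A \<longleftrightarrow> closed_alg T A \<and> (\<forall>(l, r)\<in>ids T. satisfies A l r)"

text \<open>
  HOL cannot quantify over all objects of all types inside a formula. The identities valid in
  every object are therefore tested on the objects carried by sets of terms; by the lemma
  \<open>entails_obj\<close> below, they are then valid in every object over every type.
\<close>

definition entails ::
    "('u, 'b) presentation \<Rightarrow> ('u, 'b) trm \<Rightarrow> ('u, 'b) trm \<Rightarrow> bool" where
  "entails T l r \<longleftrightarrow> (\<forall>A :: (('u, 'b) trm, 'u, 'b) alg. obj T A \<longrightarrow> satisfies A l r)"

lemma eval_closed:
  assumes "closed_alg T A" "range v \<subseteq> carr A" "wf_trm T t"
  shows "eval A v t \<in> carr A"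
  using assms(3) by (induction t) (use assms(1,2) in \<open>auto simp: closed_alg_def\<close>)

lemma entails_obj:
  fixes T :: "('u, 'b) presentation" and A :: "('a, 'u, 'b) alg"
  assumes wf: "ids T \<subseteq> {t. wf_trm T t} \<times> {t. wf_trm T t}"
    and lr: "wf_trm T l" "wf_trm T r"
    and ent: "entails T l r" and A: "obj T A"
  shows "satisfies A l r"
  unfolding satisfies_def
proof (intro allI impI)
  fix v :: "nat \<Rightarrow> 'a" assume v: "range v \<subseteq> carr A"
  have cl: "closed_alg T A" using A by (simp add: obj_def)
  define D where "D = eval A v ` {t. wf_trm T t}"
  define rep where "rep a = (SOME t. wf_trm T t \<and> eval A v t = a)" for a
  define h where "h = eval A v"
  have rep: "wf_trm T (rep a)" "h (rep a) = a" if "a \<in> D" for a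
  proof -
    have "\<exists>t. wf_trm T t \<and> eval A v t = a" using that by (auto simp: D_def)
    then have "wf_trm T (rep a) \<and> eval A v (rep a) = a" unfolding rep_def by (rule someI_ex)
    then show "wf_trm T (rep a)" "h (rep a) = a" by (auto simp: h_def)
  qed
  have D: "D \<subseteq> carr A" using eval_closed[OF cl v] by (auto simp: D_def)
  have D0: "zero A \<in> D" unfolding D_def by (rule image_eqI[of _ _ Zero]) auto
  have D1: "neg A x \<in> D" if "x \<in> D" for x
    unfolding D_def by (rule image_eqI[of _ _ "Neg (rep x)"]) (use rep[OF that] in \<open>auto simp: h_def\<close>)
  have D2: "add A x y \<in> D" if "x \<in> D" "y \<in> D" for x y
    unfolding D_def by (rule image_eqI[of _ _ "Plus (rep x) (rep y)"])
      (use rep[OF that(1)] rep[OF that(2)] in \<open>auto simp: h_def\<close>)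
  have D3: "un A w x \<in> D" if "w \<in> Om1 T" "x \<in> D" for w x
    unfolding D_def by (rule image_eqI[of _ _ "UnOp w (rep x)"])
      (use rep[OF that(2)] that(1) in \<open>auto simp: h_def\<close>)
  have D4: "bin A b x y \<in> D" if "b \<in> Om2 T" "x \<in> D" "y \<in> D" for b x y
    unfolding D_def by (rule image_eqI[of _ _ "BinOp b (rep x) (rep y)"])
      (use rep[OF that(2)] rep[OF that(3)] that(1) in \<open>auto simp: h_def\<close>)
  have DV: "v n \<in> D" for n unfolding D_def by (rule image_eqI[of _ _ "Var n"]) auto
  define B :: "(('u, 'b) trm, 'u, 'b) alg" where
    "B = \<lparr>carr = rep ` D, zero = rep (zero A), neg = (\<lambda>x. rep (neg A (h x))),
          add = (\<lambda>x y. rep (add A (h x) (h y))), un = (\<lambda>w x. rep (un A w (h x))),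
          bin = (\<lambda>b x y. rep (bin A b (h x) (h y)))\<rparr>"
  have hD: "h x \<in> D" "rep (h x) = x" if "x \<in> carr B" for x
    using that rep by (auto simp: B_def)
  have clB: "closed_alg T B"
    using hD D0 D1 D2 D3 D4 by (auto simp: closed_alg_def B_def)
  have hB: "h (zero B) = zero A"
      "x \<in> carr B \<Longrightarrow> h (neg B x) = neg A (h x)"
      "x \<in> carr B \<Longrightarrow> y \<in> carr B \<Longrightarrow> h (add B x y) = add A (h x) (h y)"
      "w \<in> Om1 T \<Longrightarrow> x \<in> carr B \<Longrightarrow> h (un B w x) = un A w (h x)"
      "b \<in> Om2 T \<Longrightarrow> x \<in> carr B \<Longrightarrow> y \<in> carr B \<Longrightarrow> h (bin B b x y) = bin A b (h x) (h y)"
    for x y w b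
    using rep(2)[OF D0] rep(2)[OF D1[OF hD(1)]] rep(2)[OF D2[OF hD(1) hD(1)]]
      rep(2)[OF D3[OF _ hD(1)]] rep(2)[OF D4[OF _ hD(1) hD(1)]]
    by (simp_all add: B_def)
  have hom: "h (eval B u t) = eval A (h \<circ> u) t" if u: "range u \<subseteq> carr B" and "wf_trm T t" for u t
    using that(2)
    by (induction t) (simp_all add: hB eval_closed[OF clB u])
  have "obj T B"
    unfolding obj_def
  proof (intro conjI clB ballI)
    fix p assume p: "p \<in> ids T"
    obtain l' r' where p': "p = (l', r')" by (cases p)
    have w: "wf_trm T l'" "wf_trm T r'" using p p' wf by auto
    have sat: "satisfies A l' r'" using A p p' by (auto simp: obj_def)
    have "eval B u l' = eval B u r'" if u: "range u \<subseteq> carr B" for u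
    proof -
      have "range (h \<circ> u) \<subseteq> carr A" using u hD(1) D by fastforce
      then have "h (eval B u l') = h (eval B u r')"
        using sat hom[OF u] w by (simp add: satisfies_def)
      then show ?thesis
        using hD(2)[OF eval_closed[OF clB u w(1)]] hD(2)[OF eval_closed[OF clB u w(2)]] by metis
    qed
    then show "case p of (l, r) \<Rightarrow> satisfies B l r" by (simp add: p' satisfies_def)
  qed
  then have satB: "satisfies B l r" using ent by (simp add: entails_def)
  define u where "u n = rep (v n)" for n
  have u: "range u \<subseteq> carr B" using DV by (auto simp: u_def B_def)
  have hu: "h \<circ> u = v" using rep(2)[OF DV] by (auto simp: u_def)
  have "eval B u l = eval B u r" using satB u by (simp add: satisfies_def)
  then have "h (eval B u l) = h (eval B u r)" by simp
  then show "eval A v l = eval A v r" using hom[OF u] lr hu by simp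
qed

section \<open>Modified categories of interest\<close>

abbreviation X1 :: "('u, 'b) trm" where "X1 \<equiv> Var 0"
abbreviation X2 :: "('u, 'b) trm" where "X2 \<equiv> Var 1"
abbreviation X3 :: "('u, 'b) trm" where "X3 \<equiv> Var 2"

definition group_ids :: "(('u, 'b) trm \<times> ('u, 'b) trm) set" where
  "group_ids =
     {(Plus (Plus X1 X2) X3, Plus X1 (Plus X2 X3)),
      (Plus Zero X1, X1), (Plus X1 Zero, X1),
      (Plus (Neg X1) X1, Zero), (Plus X1 (Neg X1), Zero)}"

text \<open>
  The eight arguments of the word \<open>W\<close> in the last axiom below. In the \<open>i\<close>-th argument the outer
  juxtaposition is the operation \<open>f i\<close> and the inner one is \<open>g i\<close>.
\<close>

definition args :: "(nat \<Rightarrow> 'b) \<Rightarrow> (nat \<Rightarrow> 'b) \<Rightarrow> ('u, 'b) trm list" where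
  "args f g =
     [BinOp (f 0) X1 (BinOp (g 0) X2 X3),
      BinOp (f 1) X1 (BinOp (g 1) X3 X2),
      BinOp (f 2) (BinOp (g 2) X2 X3) X1,
      BinOp (f 3) (BinOp (g 3) X3 X2) X1,
      BinOp (f 4) X2 (BinOp (g 4) X1 X3),
      BinOp (f 5) X2 (BinOp (g 5) X3 X1),
      BinOp (f 6) (BinOp (g 6) X1 X3) X2,
      BinOp (f 7) (BinOp (g 7) X3 X1) X2]"

text \<open>
  That the identities include \<open>l = r\<close> is read as validity of \<open>l = r\<close> in all objects, so that it does
  not depend on the names of variables or on the choice of axioms in \<open>ids T\<close>. Membership
  \<open>(l, r) \<in> ids T\<close> implies it. The third clause provides the opposite operation \<open>b'\<close> of \<open>b\<close>.
\<close>

definition mci :: "('u, 'b) presentation \<Rightarrow> bool" where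
  "mci T \<longleftrightarrow>
     ids T \<subseteq> {t. wf_trm T t} \<times> {t. wf_trm T t} \<and>
     (\<forall>(l, r)\<in>group_ids. entails T l r) \<and>
     (\<forall>b\<in>Om2 T. \<exists>b'\<in>Om2 T. entails T (BinOp b' X1 X2) (BinOp b X2 X1)) \<and>
     (\<forall>b\<in>Om2 T. entails T (BinOp b X1 (Plus X2 X3)) (Plus (BinOp b X1 X2) (BinOp b X1 X3))) \<and>
     (\<forall>w\<in>Om1 T. \<forall>b\<in>Om2 T.
        entails T (UnOp w (Plus X1 X2)) (Plus (UnOp w X1) (UnOp w X2)) \<and>
        (entails T (UnOp w (BinOp b X1 X2)) (BinOp b (UnOp w X1) (UnOp w X2)) \<or>
         entails T (UnOp w (BinOp b X1 X2)) (BinOp b (UnOp w X1) X2))) \<and>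
     (\<forall>b\<in>Om2 T. entails T (Plus X1 (BinOp b X2 X3)) (Plus (BinOp b X2 X3) X1)) \<and>
     (\<forall>b\<in>Om2 T. \<forall>c\<in>Om2 T.
        \<exists>W f g. wf_trm T W \<and> vars W \<subseteq> {..<8} \<and> range f \<subseteq> Om2 T \<and> range g \<subseteq> Om2 T \<and>
          entails T (BinOp c (BinOp b X1 X2) X3) (subst (\<lambda>i. args f g ! i) W))"

definition mor :: "('u, 'b) presentation \<Rightarrow> ('a, 'u, 'b) alg \<Rightarrow> ('c, 'u, 'b) alg \<Rightarrow> ('a \<Rightarrow> 'c) \<Rightarrow> bool"
  where
  "mor T A B f \<longleftrightarrow>
     obj T A \<and> obj T B \<and> f \<in> carr A \<rightarrow> carr B \<and>
     (\<forall>x\<in>carr A. \<forall>y\<in>carr A. f (add A x y) = add B (f x) (f y)) \<and>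
     (\<forall>b\<in>Om2 T. \<forall>x\<in>carr A. \<forall>y\<in>carr A. f (bin A b x y) = bin B b (f x) (f y)) \<and>
     (\<forall>w\<in>Om1 T. \<forall>x\<in>carr A. f (un A w x) = un B w (f x))"

definition ker :: "('a, 'u, 'b) alg \<Rightarrow> ('c, 'u, 'b) alg \<Rightarrow> ('a \<Rightarrow> 'c) \<Rightarrow> 'a set" where
  "ker A B f = {x \<in> carr A. f x = zero B}"

definition subobject :: "('u, 'b) presentation \<Rightarrow> ('a, 'u, 'b) alg \<Rightarrow> ('a, 'u, 'b) alg \<Rightarrow> bool" where
  "subobject T A B \<longleftrightarrow> carr A \<subseteq> carr B \<and> mor T A B (\<lambda>x. x)"

definition prod_alg :: "('a, 'u, 'b) alg \<Rightarrow> ('c, 'u, 'b) alg \<Rightarrow> ('a \<times> 'c, 'u, 'b) alg" where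
  "prod_alg A B =
     \<lparr>carr = carr A \<times> carr B,
      zero = (zero A, zero B),
      neg = (\<lambda>(x, y). (neg A x, neg B y)),
      add = (\<lambda>(x, y) (x', y'). (add A x x', add B y y')),
      un = (\<lambda>w (x, y). (un A w x, un B w y)),
      bin = (\<lambda>b (x, y) (x', y'). (bin A b x x', bin B b y y'))\<rparr>"

section \<open>Cat1-objects\<close>

record ('r, 's, 'u, 'b) cat1 =
  top_obj :: "('r, 'u, 'b) alg"
  base_obj :: "('s, 'u, 'b) alg"
  emb :: "'s \<Rightarrow> 'r"
  src :: "'r \<Rightarrow> 's"
  tgt :: "'r \<Rightarrow> 's"

text \<open>
  Injectivity of the embedding is a consequence of \<open>src X (emb X x) = x\<close>.
\<close>

definition cat1_object :: "('u, 'b) presentation \<Rightarrow> ('r, 's, 'u, 'b) cat1 \<Rightarrow> bool" where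
  "cat1_object T X \<longleftrightarrow>
     (let R = top_obj X; S = base_obj X in
       mor T R S (src X) \<and> mor T R S (tgt X) \<and> mor T S R (emb X) \<and>
       (\<forall>x\<in>carr S. src X (emb X x) = x) \<and>
       (\<forall>x\<in>carr S. tgt X (emb X x) = x) \<and>
       (\<forall>x\<in>ker R S (src X). \<forall>y\<in>ker R S (tgt X).
          (\<forall>b\<in>Om2 T. bin R b x y = zero R) \<and>
          add R (add R (add R x y) (neg R x)) (neg R y) = zero R))"

text \<open>
  A morphism is a pair of functions. Only their values on the carriers matter, so two parallel
  morphisms are identified by \<open>cat1_agree\<close>.
\<close>

definition cat1_mor ::
    "('u, 'b) presentation \<Rightarrow> ('r, 's, 'u, 'b) cat1 \<Rightarrow> ('p, 'q, 'u, 'b) cat1 \<Rightarrow>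
      ('r \<Rightarrow> 'p) \<times> ('s \<Rightarrow> 'q) \<Rightarrow> bool" where
  "cat1_mor T X Y F \<longleftrightarrow>
     (case F of (f, g) \<Rightarrow>
       cat1_object T X \<and> cat1_object T Y \<and>
       mor T (top_obj X) (top_obj Y) f \<and> mor T (base_obj X) (base_obj Y) g \<and>
       (\<forall>x\<in>carr (top_obj X). src Y (f x) = g (src X x)) \<and>
       (\<forall>x\<in>carr (top_obj X). tgt Y (f x) = g (tgt X x)) \<and>
       (\<forall>x\<in>carr (base_obj X). f (emb X x) = emb Y (g x)))"

definition cat1_comp ::
    "('p \<Rightarrow> 'm) \<times> ('q \<Rightarrow> 'n) \<Rightarrow> ('r \<Rightarrow> 'p) \<times> ('s \<Rightarrow> 'q) \<Rightarrow> ('r \<Rightarrow> 'm) \<times> ('s \<Rightarrow> 'n)" where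
  "cat1_comp G F = (fst G \<circ> fst F, snd G \<circ> snd F)"

definition cat1_agree ::
    "('r, 's, 'u, 'b) cat1 \<Rightarrow> ('r \<Rightarrow> 'p) \<times> ('s \<Rightarrow> 'q) \<Rightarrow> ('r \<Rightarrow> 'p) \<times> ('s \<Rightarrow> 'q) \<Rightarrow> bool" where
  "cat1_agree X F G \<longleftrightarrow>
     (\<forall>x\<in>carr (top_obj X). fst F x = fst G x) \<and> (\<forall>x\<in>carr (base_obj X). snd F x = snd G x)"

section \<open>The pullback along a morphism into the base\<close>

definition pb_alg ::
    "('r, 's, 'u, 'b) cat1 \<Rightarrow> ('q, 'u, 'b) alg \<Rightarrow> ('q \<Rightarrow> 's) \<Rightarrow> ('q \<times> 'r \<times> 'q, 'u, 'b) alg" where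
  "pb_alg X Q \<phi> =
     (prod_alg Q (prod_alg (top_obj X) Q))
       \<lparr>carr := {(q1, r, q2). q1 \<in> carr Q \<and> r \<in> carr (top_obj X) \<and> q2 \<in> carr Q \<and>
                             \<phi> q1 = src X r \<and> \<phi> q2 = tgt X r}\<rparr>"

definition pb_cat1 ::
    "('r, 's, 'u, 'b) cat1 \<Rightarrow> ('q, 'u, 'b) alg \<Rightarrow> ('q \<Rightarrow> 's) \<Rightarrow> ('q \<times> 'r \<times> 'q, 'q, 'u, 'b) cat1" where
  "pb_cat1 X Q \<phi> =
     \<lparr>top_obj = pb_alg X Q \<phi>,
      base_obj = Q,
      emb = (\<lambda>q. (q, emb X (\<phi> q), q)),
      src = (\<lambda>(q1, r, q2). q1),
      tgt = (\<lambda>(q1, r, q2). q2)\<rparr>"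

definition pb_proj :: "'q \<times> 'r \<times> 'q \<Rightarrow> 'r" where
  "pb_proj = (\<lambda>(q1, r, q2). r)"

end

theory Submission
  imports Defs
begin

text \<open>
  The pullback cat1-object has as its underlying object the limit of the diagram
  \<open>Q \<rightarrow> S \<leftarrow> R \<rightarrow> S \<leftarrow> Q\<close> with the maps \<open>\<phi>, s, t, \<phi>\<close>, and most of the theorem is the observation
  that a category of algebras defined by identities is closed under such limits: identities hold
  componentwise in a product (\<open>obj_prod_alg\<close>) and pass to every subset closed under the operations
  (\<open>obj_subalgebra\<close>). The set of compatible triples is closed since \<open>\<phi>, s, t\<close> are morphisms; that
  they respect \<open>0\<close> and \<open>-\<close>, which a morphism is not assumed to do, comes from the group identities
  (\<open>mor_zero\<close>, \<open>mor_neg\<close>).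

  The one condition on a cat1-object that is not formal is that \<open>ker s\<^sup>\<star>\<close> and \<open>ker t\<^sup>\<star>\<close> annihilate
  and commute with each other. Elements of these kernels have the form \<open>(0, r, q)\<close> and
  \<open>(q', r', 0)\<close>, and compatibility gives \<open>s r = \<phi> 0 = 0\<close> and \<open>t r' = \<phi> 0 = 0\<close>. The middle component
  of \<open>(0, r, q) * (q', r', 0)\<close> therefore vanishes by the condition on \<open>(e; s, t)\<close>, and the outer
  components \<open>0 * q'\<close> and \<open>q * 0\<close> vanish because \<open>*\<close> is additive in both variables
  (\<open>bin_zero\<close>). The commutator is treated in the same way.

  For the universal property, the conditions \<open>s\<^sup>\<star> \<psi> = s'\<close>, \<open>\<pi> \<psi> = \<chi>\<close> and \<open>t\<^sup>\<star> \<psi> = t'\<close> say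
  precisely that \<open>\<psi> p = (s' p, \<chi> p, t' p)\<close>. This settles uniqueness, and the equations
  \<open>s \<chi> = \<phi> s'\<close> and \<open>t \<chi> = \<phi> t'\<close> say that this triple lies in the pullback.
\<close>

section \<open>Products and subalgebras\<close>

lemma eval_prod_alg:
  "eval (prod_alg A B) v t = (eval A (fst \<circ> v) t, eval B (snd \<circ> v) t)"
  by (induction t) (simp_all add: prod_alg_def split_beta)

lemma obj_prod_alg:
  assumes A: "obj T A" and B: "obj T B"
  shows "obj T (prod_alg A B)"
proof -
  have "closed_alg T (prod_alg A B)"
    using A B by (auto simp: obj_def closed_alg_def prod_alg_def)
  moreover have "satisfies (prod_alg A B) l r" if "(l, r) \<in> ids T" for l r
    unfolding satisfies_def
  proof (intro allI impI)
    fix v :: "nat \<Rightarrow> _" assume "range v \<subseteq> carr (prod_alg A B)"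
    then have "v n \<in> carr A \<times> carr B" for n by (auto simp: prod_alg_def)
    then have "range (fst \<circ> v) \<subseteq> carr A" "range (snd \<circ> v) \<subseteq> carr B"
      by (auto simp: mem_Times_iff)
    moreover have "satisfies A l r" "satisfies B l r" using A B that by (auto simp: obj_def)
    ultimately show "eval (prod_alg A B) v l = eval (prod_alg A B) v r"
      by (simp add: eval_prod_alg satisfies_def)
  qed
  ultimately show ?thesis by (auto simp: obj_def)
qed

lemma eval_carr_update: "eval (A\<lparr>carr := C\<rparr>) v t = eval A v t"
  by (induction t) simp_all

lemma obj_subalgebra:
  assumes "obj T A" and "C \<subseteq> carr A" and "closed_alg T (A\<lparr>carr := C\<rparr>)"
  shows "obj T (A\<lparr>carr := C\<rparr>)"
  using assms by (fastforce simp: obj_def satisfies_def eval_carr_update)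

lemma subobject_subalgebra:
  assumes A: "obj T A" and C: "C \<subseteq> carr A" and cl: "closed_alg T (A\<lparr>carr := C\<rparr>)"
  shows "subobject T (A\<lparr>carr := C\<rparr>) A"
  using obj_subalgebra[OF assms] A C by (auto simp: subobject_def mor_def)

section \<open>Group laws and bilinearity in an object\<close>

text \<open>
  The clauses defining a modified category of interest use at most the variables \<open>X1, X2, X3\<close>, so
  each of them becomes a law for elements of an object through a valuation of this form.
\<close>

lemma entails_at:
  assumes T: "mci T" and ent: "entails T l r" and wf: "wf_trm T l" "wf_trm T r"
    and A: "obj T A" and xyz: "x \<in> carr A" "y \<in> carr A" "z \<in> carr A"
  defines "v \<equiv> \<lambda>n::nat. if n = 0 then x else if n = 1 then y else z"
  shows "eval A v l = eval A v r"
proof -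
  have "satisfies A l r"
    using T by (intro entails_obj[OF _ wf ent A]) (simp add: mci_def)
  moreover have "range v \<subseteq> carr A" using xyz by (auto simp: v_def)
  ultimately show ?thesis by (simp add: satisfies_def)
qed

lemma obj_closed:
  assumes "obj T A"
  shows "zero A \<in> carr A"
    and "x \<in> carr A \<Longrightarrow> neg A x \<in> carr A"
    and "x \<in> carr A \<Longrightarrow> y \<in> carr A \<Longrightarrow> add A x y \<in> carr A"
    and "w \<in> Om1 T \<Longrightarrow> x \<in> carr A \<Longrightarrow> un A w x \<in> carr A"
    and "b \<in> Om2 T \<Longrightarrow> x \<in> carr A \<Longrightarrow> y \<in> carr A \<Longrightarrow> bin A b x y \<in> carr A"
  using assms by (auto simp: obj_def closed_alg_def)

lemma group_laws:
  assumes T: "mci T" and A: "obj T A" and xyz: "x \<in> carr A" "y \<in> carr A" "z \<in> carr A"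
  shows "add A (add A x y) z = add A x (add A y z)"
    and "add A (zero A) x = x" and "add A x (zero A) = x"
    and "add A (neg A x) x = zero A" and "add A x (neg A x) = zero A"
proof -
  have ent: "entails T l r" if "(l, r) \<in> group_ids" for l r
    using T that by (auto simp: mci_def)
  note at = entails_at[OF T ent _ _ A xyz]
  show "add A (add A x y) z = add A x (add A y z)"
    using at[of "Plus (Plus X1 X2) X3" "Plus X1 (Plus X2 X3)"] by (simp add: group_ids_def)
  show "add A (zero A) x = x"
    using at[of "Plus Zero X1" X1] by (simp add: group_ids_def)
  show "add A x (zero A) = x"
    using at[of "Plus X1 Zero" X1] by (simp add: group_ids_def)
  show "add A (neg A x) x = zero A"
    using at[of "Plus (Neg X1) X1" Zero] by (simp add: group_ids_def)
  show "add A x (neg A x) = zero A"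
    using at[of "Plus X1 (Neg X1)" Zero] by (simp add: group_ids_def)
qed

lemma add_idem_zero:
  assumes T: "mci T" and A: "obj T A" and x: "x \<in> carr A" and idem: "add A x x = x"
  shows "x = zero A"
proof -
  note laws = group_laws[OF T A]
  have n: "neg A x \<in> carr A" using obj_closed(2)[OF A x] .
  have "x = add A (add A (neg A x) x) x" using laws[OF x x x] by simp
  also have "\<dots> = add A (neg A x) (add A x x)" using laws(1)[OF n x x] .
  also have "\<dots> = zero A" using idem laws(4)[OF x x x] by simp
  finally show ?thesis .
qed

lemma neg_unique:
  assumes T: "mci T" and A: "obj T A" and x: "x \<in> carr A" and y: "y \<in> carr A"
    and sum: "add A x y = zero A"
  shows "y = neg A x"
proof -
  note laws = group_laws[OF T A]
  have n: "neg A x \<in> carr A" using obj_closed(2)[OF A x] .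
  have "y = add A (add A (neg A x) x) y" using laws[OF x x x] laws(2)[OF y y y] by simp
  also have "\<dots> = add A (neg A x) (add A x y)" using laws(1)[OF n x y] .
  also have "\<dots> = neg A x" using sum laws(3)[OF n n n] by simp
  finally show ?thesis .
qed

lemma neg_zero:
  assumes T: "mci T" and A: "obj T A"
  shows "neg A (zero A) = zero A"
  using neg_unique[OF T A] group_laws(2)[OF T A] obj_closed(1)[OF A] by metis

text \<open>
  Additivity is an axiom in the second variable only; in the first variable it is inherited from
  the opposite operation.
\<close>

lemma bin_zero:
  assumes T: "mci T" and A: "obj T A" and b: "b \<in> Om2 T" and x: "x \<in> carr A"
  shows "bin A b x (zero A) = zero A" and "bin A b (zero A) x = zero A"
proof -
  have z: "zero A \<in> carr A" using obj_closed(1)[OF A] .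
  have right: "bin A c x (zero A) = zero A" if c: "c \<in> Om2 T" for c
  proof -
    have "entails T (BinOp c X1 (Plus X2 X3)) (Plus (BinOp c X1 X2) (BinOp c X1 X3))"
      using T c by (auto simp: mci_def)
    from entails_at[OF T this _ _ A x z z]
    have "bin A c x (add A (zero A) (zero A)) =
        add A (bin A c x (zero A)) (bin A c x (zero A))"
      using c by simp
    then have "add A (bin A c x (zero A)) (bin A c x (zero A)) = bin A c x (zero A)"
      using group_laws(2)[OF T A z z z] by simp
    then show ?thesis using add_idem_zero[OF T A] obj_closed(5)[OF A c x z] by blast
  qed
  show "bin A b x (zero A) = zero A" using right[OF b] .
  obtain c where c: "c \<in> Om2 T" "entails T (BinOp c X1 X2) (BinOp b X2 X1)"
    using T b by (auto simp: mci_def)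
  from entails_at[OF T c(2) _ _ A x z z] have "bin A c x (zero A) = bin A b (zero A) x"
    using b c(1) by simp
  then show "bin A b (zero A) x = zero A" using right[OF c(1)] by simp
qed

section \<open>Morphisms\<close>

lemma morD:
  assumes "mor T A B f"
  shows "obj T A" and "obj T B"
    and "x \<in> carr A \<Longrightarrow> f x \<in> carr B"
    and "x \<in> carr A \<Longrightarrow> y \<in> carr A \<Longrightarrow> f (add A x y) = add B (f x) (f y)"
    and "b \<in> Om2 T \<Longrightarrow> x \<in> carr A \<Longrightarrow> y \<in> carr A \<Longrightarrow> f (bin A b x y) = bin B b (f x) (f y)"
    and "w \<in> Om1 T \<Longrightarrow> x \<in> carr A \<Longrightarrow> f (un A w x) = un B w (f x)"
  using assms by (auto simp: mor_def)

lemma mor_zero: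
  assumes T: "mci T" and f: "mor T A B f"
  shows "f (zero A) = zero B"
proof -
  note A = morD(1)[OF f]
  have z: "zero A \<in> carr A" using obj_closed(1)[OF A] .
  have "add B (f (zero A)) (f (zero A)) = f (zero A)"
    using morD(4)[OF f z z] group_laws(2)[OF T A z z z] by simp
  then show ?thesis using add_idem_zero[OF T morD(2)[OF f] morD(3)[OF f z]] by blast
qed

lemma mor_neg:
  assumes T: "mci T" and f: "mor T A B f" and x: "x \<in> carr A"
  shows "f (neg A x) = neg B (f x)"
proof -
  note A = morD(1)[OF f]
  have n: "neg A x \<in> carr A" using obj_closed(2)[OF A x] .
  have "add B (f x) (f (neg A x)) = zero B"
    using morD(4)[OF f x n] group_laws(5)[OF T A x x x] mor_zero[OF T f] by simp
  then show ?thesis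
    using neg_unique[OF T morD(2)[OF f] morD(3)[OF f x] morD(3)[OF f n]] by blast
qed

lemma mor_id: "obj T A \<Longrightarrow> mor T A A id"
  by (simp add: mor_def)

lemma cat1_objectD:
  assumes "cat1_object T X"
  shows "mor T (top_obj X) (base_obj X) (src X)"
    and "mor T (top_obj X) (base_obj X) (tgt X)"
    and "mor T (base_obj X) (top_obj X) (emb X)"
    and "q \<in> carr (base_obj X) \<Longrightarrow> src X (emb X q) = q"
    and "q \<in> carr (base_obj X) \<Longrightarrow> tgt X (emb X q) = q"
    and "x \<in> carr (top_obj X) \<Longrightarrow> y \<in> carr (top_obj X) \<Longrightarrow>
      src X x = zero (base_obj X) \<Longrightarrow> tgt X y = zero (base_obj X) \<Longrightarrow>
      b \<in> Om2 T \<Longrightarrow> bin (top_obj X) b x y = zero (top_obj X)"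
    and "x \<in> carr (top_obj X) \<Longrightarrow> y \<in> carr (top_obj X) \<Longrightarrow>
      src X x = zero (base_obj X) \<Longrightarrow> tgt X y = zero (base_obj X) \<Longrightarrow>
      add (top_obj X) (add (top_obj X) (add (top_obj X) x y) (neg (top_obj X) x))
        (neg (top_obj X) y) = zero (top_obj X)"
  using assms by (auto simp: cat1_object_def Let_def ker_def)

section \<open>The pullback object\<close>

lemma pb_alg_simps:
  "(q1, r, q2) \<in> carr (pb_alg X Q \<phi>) \<longleftrightarrow>
     q1 \<in> carr Q \<and> r \<in> carr (top_obj X) \<and> q2 \<in> carr Q \<and> \<phi> q1 = src X r \<and> \<phi> q2 = tgt X r"
  "zero (pb_alg X Q \<phi>) = (zero Q, zero (top_obj X), zero Q)"
  "neg (pb_alg X Q \<phi>) (q1, r, q2) = (neg Q q1, neg (top_obj X) r, neg Q q2)"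
  "add (pb_alg X Q \<phi>) (q1, r, q2) (q1', r', q2') =
     (add Q q1 q1', add (top_obj X) r r', add Q q2 q2')"
  "un (pb_alg X Q \<phi>) w (q1, r, q2) = (un Q w q1, un (top_obj X) w r, un Q w q2)"
  "bin (pb_alg X Q \<phi>) b (q1, r, q2) (q1', r', q2') =
     (bin Q b q1 q1', bin (top_obj X) b r r', bin Q b q2 q2')"
  by (simp_all add: pb_alg_def prod_alg_def)

lemma pb_cat1_simps:
  "top_obj (pb_cat1 X Q \<phi>) = pb_alg X Q \<phi>" "base_obj (pb_cat1 X Q \<phi>) = Q"
  "emb (pb_cat1 X Q \<phi>) q = (q, emb X (\<phi> q), q)"
  "src (pb_cat1 X Q \<phi>) (q1, r, q2) = q1" "tgt (pb_cat1 X Q \<phi>) (q1, r, q2) = q2"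
  "pb_proj (q1, r, q2) = r"
  by (simp_all add: pb_cat1_def pb_proj_def)

context
  fixes T :: "('u, 'b) presentation"
    and X :: "('r, 's, 'u, 'b) cat1"
    and Q :: "('q, 'u, 'b) alg"
    and \<phi> :: "'q \<Rightarrow> 's"
  assumes T: "mci T" and X: "cat1_object T X" and \<phi>: "mor T Q (base_obj X) \<phi>"
begin

private lemmas s = cat1_objectD(1)[OF X]
private lemmas t = cat1_objectD(2)[OF X]
private lemmas e = cat1_objectD(3)[OF X]
private lemmas R_obj = morD(1)[OF s]
private lemmas Q_obj = morD(1)[OF \<phi>]

lemma closed_alg_pb_alg: "closed_alg T (pb_alg X Q \<phi>)"
  unfolding closed_alg_def
  by (auto simp: pb_alg_simps obj_closed[OF R_obj] obj_closed[OF Q_obj]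
      mor_zero[OF T \<phi>] mor_zero[OF T s] mor_zero[OF T t]
      mor_neg[OF T \<phi>] mor_neg[OF T s] mor_neg[OF T t] morD[OF \<phi>] morD[OF s] morD[OF t])

lemma subobject_pb_alg: "subobject T (pb_alg X Q \<phi>) (prod_alg Q (prod_alg (top_obj X) Q))"
  unfolding pb_alg_def
proof (rule subobject_subalgebra)
  show "obj T (prod_alg Q (prod_alg (top_obj X) Q))"
    by (intro obj_prod_alg Q_obj R_obj)
  show "closed_alg T ((prod_alg Q (prod_alg (top_obj X) Q))\<lparr>carr := {(q1, r, q2).
      q1 \<in> carr Q \<and> r \<in> carr (top_obj X) \<and> q2 \<in> carr Q \<and> \<phi> q1 = src X r \<and> \<phi> q2 = tgt X r}\<rparr>)"
    using closed_alg_pb_alg unfolding pb_alg_def .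
qed (auto simp: prod_alg_def)

lemma obj_pb_alg: "obj T (pb_alg X Q \<phi>)"
  using subobject_pb_alg by (auto simp: subobject_def mor_def)

lemma mor_pb_proj: "mor T (pb_alg X Q \<phi>) (top_obj X) pb_proj"
  unfolding mor_def by (auto simp: obj_pb_alg R_obj pb_alg_simps pb_cat1_simps)

text \<open>
  The condition on kernels for the pullback reduces to the one for \<open>X\<close> because the middle components
  lie in \<open>ker (src X)\<close> and \<open>ker (tgt X)\<close>: each is sent to the image under \<open>\<phi>\<close> of an outer component
  that is zero.
\<close>

lemma pb_kernels:
  assumes x: "x \<in> ker (pb_alg X Q \<phi>) Q (src (pb_cat1 X Q \<phi>))"
    and y: "y \<in> ker (pb_alg X Q \<phi>) Q (tgt (pb_cat1 X Q \<phi>))"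
  obtains r q q' r' where "x = (zero Q, r, q)" "y = (q', r', zero Q)"
    "r \<in> carr (top_obj X)" "q \<in> carr Q" "q' \<in> carr Q" "r' \<in> carr (top_obj X)"
    "src X r = zero (base_obj X)" "tgt X r' = zero (base_obj X)"
proof -
  obtain q1 r q where x': "x = (q1, r, q)" by (cases x) auto
  obtain q' r' q2 where y': "y = (q', r', q2)" by (cases y) auto
  show thesis
    using x y x' y' mor_zero[OF T \<phi>]
    by (intro that[of r q q' r']) (auto simp: ker_def pb_alg_simps pb_cat1_simps)
qed

lemma cat1_object_pb_cat1: "cat1_object T (pb_cat1 X Q \<phi>)"
proof -
  let ?P = "pb_alg X Q \<phi>" and ?s = "src (pb_cat1 X Q \<phi>)" and ?t = "tgt (pb_cat1 X Q \<phi>)"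
  have mor_s: "mor T ?P Q ?s" and mor_t: "mor T ?P Q ?t"
    unfolding mor_def by (auto simp: obj_pb_alg Q_obj pb_alg_simps pb_cat1_simps)
  have mor_e: "mor T Q ?P (emb (pb_cat1 X Q \<phi>))"
    unfolding mor_def
    by (auto simp: obj_pb_alg Q_obj pb_alg_simps pb_cat1_simps cat1_objectD(4,5)[OF X]
        morD[OF \<phi>] morD[OF e])
  have ker: "(\<forall>b\<in>Om2 T. bin ?P b x y = zero ?P) \<and>
      add ?P (add ?P (add ?P x y) (neg ?P x)) (neg ?P y) = zero ?P"
    if x: "x \<in> ker ?P Q ?s" and y: "y \<in> ker ?P Q ?t" for x y
  proof -
    obtain r q q' r' where xy: "x = (zero Q, r, q)" "y = (q', r', zero Q)"
      and mem: "r \<in> carr (top_obj X)" "q \<in> carr Q" "q' \<in> carr Q" "r' \<in> carr (top_obj X)"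
      and st: "src X r = zero (base_obj X)" "tgt X r' = zero (base_obj X)"
      using pb_kernels[OF x y] by metis
    have z: "zero Q \<in> carr Q" using obj_closed(1)[OF Q_obj] .
    note laws = group_laws(2-5)[OF T Q_obj _ z z]
    show ?thesis
      using mem z cat1_objectD(6,7)[OF X mem(1,4) st]
      by (simp add: xy pb_alg_simps bin_zero[OF T Q_obj] neg_zero[OF T Q_obj] laws)
  qed
  show ?thesis
    using mor_s mor_t mor_e ker by (auto simp: cat1_object_def Let_def pb_cat1_simps)
qed

lemma cat1_mor_pb_proj: "cat1_mor T (pb_cat1 X Q \<phi>) X (pb_proj, \<phi>)"
  using cat1_object_pb_cat1 X mor_pb_proj \<phi>
  by (auto simp: cat1_mor_def pb_cat1_simps pb_alg_simps)

section \<open>The universal property\<close>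

context
  fixes Y :: "('p, 'q, 'u, 'b) cat1" and \<chi> :: "'p \<Rightarrow> 'r"
  assumes base: "base_obj Y = Q" and \<chi>: "cat1_mor T Y X (\<chi>, \<phi>)"
begin

lemma cat1_mor_pb_lift: "cat1_mor T Y (pb_cat1 X Q \<phi>) (\<lambda>p. (src Y p, \<chi> p, tgt Y p), id)"
proof -
  have Y: "cat1_object T Y" and mor_\<chi>: "mor T (top_obj Y) (top_obj X) \<chi>"
    and sq: "\<And>p. p \<in> carr (top_obj Y) \<Longrightarrow> src X (\<chi> p) = \<phi> (src Y p)"
      "\<And>p. p \<in> carr (top_obj Y) \<Longrightarrow> tgt X (\<chi> p) = \<phi> (tgt Y p)"
      "\<And>q. q \<in> carr Q \<Longrightarrow> \<chi> (emb Y q) = emb X (\<phi> q)"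
    using \<chi> base by (auto simp: cat1_mor_def)
  note s' = cat1_objectD(1)[OF Y, unfolded base] and t' = cat1_objectD(2)[OF Y, unfolded base]
    and e' = cat1_objectD(4,5)[OF Y, unfolded base]
  have "mor T (top_obj Y) (pb_alg X Q \<phi>) (\<lambda>p. (src Y p, \<chi> p, tgt Y p))"
    unfolding mor_def
    by (auto simp: obj_pb_alg morD(1)[OF mor_\<chi>] pb_alg_simps sq
        morD(3-)[OF s'] morD(3-)[OF t'] morD(3-)[OF mor_\<chi>])
  then show ?thesis
    using Y cat1_object_pb_cat1 mor_id[OF Q_obj] sq e'
    by (auto simp: cat1_mor_def base pb_cat1_simps)
qed

lemma pb_lift_unique:
  assumes \<psi>: "cat1_mor T Y (pb_cat1 X Q \<phi>) (\<psi>, id)"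
    and fac: "cat1_agree Y (cat1_comp (pb_proj, \<phi>) (\<psi>, id)) (\<chi>, \<phi>)"
    and p: "p \<in> carr (top_obj Y)"
  shows "\<psi> p = (src Y p, \<chi> p, tgt Y p)"
proof -
  obtain q1 r q2 where qrq: "\<psi> p = (q1, r, q2)" by (cases "\<psi> p") auto
  have "src (pb_cat1 X Q \<phi>) (\<psi> p) = src Y p" "tgt (pb_cat1 X Q \<phi>) (\<psi> p) = tgt Y p"
    using \<psi> p by (auto simp: cat1_mor_def)
  moreover have "pb_proj (\<psi> p) = \<chi> p"
    using fac p by (simp add: cat1_agree_def cat1_comp_def)
  ultimately show ?thesis by (simp add: qrq pb_cat1_simps)
qed

end

end

theorem mainTheorem3:
  fixes T :: "('u, 'b) presentation"
    and X :: "('r, 's, 'u, 'b) cat1"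
    and Q :: "('q, 'u, 'b) alg"
    and \<phi> :: "'q \<Rightarrow> 's"
  assumes "mci T"
    and "cat1_object T X"
    and "mor T Q (base_obj X) \<phi>"
  shows "subobject T (pb_alg X Q \<phi>) (prod_alg Q (prod_alg (top_obj X) Q)) \<and>
    cat1_object T (pb_cat1 X Q \<phi>) \<and>
    cat1_mor T (pb_cat1 X Q \<phi>) X (pb_proj, \<phi>) \<and>
    (\<forall>(Y :: ('p, 'q, 'u, 'b) cat1) \<chi>.
       base_obj Y = Q \<and> cat1_mor T Y X (\<chi>, \<phi>) \<longrightarrow>
       (\<exists>\<psi>. cat1_mor T Y (pb_cat1 X Q \<phi>) (\<psi>, id) \<and>
            cat1_agree Y (cat1_comp (pb_proj, \<phi>) (\<psi>, id)) (\<chi>, \<phi>) \<and>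
            (\<forall>\<psi>'. cat1_mor T Y (pb_cat1 X Q \<phi>) (\<psi>', id) \<and>
                  cat1_agree Y (cat1_comp (pb_proj, \<phi>) (\<psi>', id)) (\<chi>, \<phi>) \<longrightarrow>
                  cat1_agree Y (\<psi>', id) (\<psi>, id))))"
proof (intro conjI allI impI)
  show "subobject T (pb_alg X Q \<phi>) (prod_alg Q (prod_alg (top_obj X) Q))"
    by (rule subobject_pb_alg[OF assms])
  show "cat1_object T (pb_cat1 X Q \<phi>)"
    by (rule cat1_object_pb_cat1[OF assms])
  show "cat1_mor T (pb_cat1 X Q \<phi>) X (pb_proj, \<phi>)"
    by (rule cat1_mor_pb_proj[OF assms])
  fix Y :: "('p, 'q, 'u, 'b) cat1" and \<chi>
  assume Y: "base_obj Y = Q \<and> cat1_mor T Y X (\<chi>, \<phi>)"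
  then have base: "base_obj Y = Q" and \<chi>: "cat1_mor T Y X (\<chi>, \<phi>)" by auto
  let ?\<psi> = "\<lambda>p. (src Y p, \<chi> p, tgt Y p)"
  have "cat1_agree Y (cat1_comp (pb_proj, \<phi>) (?\<psi>, id)) (\<chi>, \<phi>)"
    by (simp add: cat1_agree_def cat1_comp_def pb_cat1_simps)
  then show "\<exists>\<psi>. cat1_mor T Y (pb_cat1 X Q \<phi>) (\<psi>, id) \<and>
      cat1_agree Y (cat1_comp (pb_proj, \<phi>) (\<psi>, id)) (\<chi>, \<phi>) \<and>
      (\<forall>\<psi>'. cat1_mor T Y (pb_cat1 X Q \<phi>) (\<psi>', id) \<and>
            cat1_agree Y (cat1_comp (pb_proj, \<phi>) (\<psi>', id)) (\<chi>, \<phi>) \<longrightarrow>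
            cat1_agree Y (\<psi>', id) (\<psi>, id))"
    using cat1_mor_pb_lift[OF assms base \<chi>]
    by (intro exI[of _ ?\<psi>] conjI allI impI)
      (simp_all add: cat1_agree_def[of Y "(_, id)" "(_, id)"] pb_lift_unique[OF assms base \<chi>])
qed

end
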